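(* Let $D$ be an integral domain, let $A=\{f\in D[X] : f(0)=1\}$, and let $D[X]_A$ be the Anderson ring of $D$. Then $D$ has finite $w$-character if and only if $D[X]_A$ has finite $w$-character.
   Context: The Anderson ring $D[X]_A$ is the localization of the polynomial ring $D[X]$ at the multiplicative set $A$ of polynomials with constant term $1$. For an integral domain $E$ with quotient field $L$ and a nonzero fractional ideal $I$ of $E$: $I^{-1}=\{a\in L : aI\subseteq E\}$ and $I_v=(I^{-1})^{-1}$. $\mathrm{GV}(E)$ is the set of (nonzero) finitely generated ideals $J$ of $E$ with $J_v=E$, and $I_w=\{x\in L : xJ\subseteq I \text{ for some } J\in \mathrm{GV}(E)\}$. A nonzero (fractional) ideal $I$ is a $w$-ideal if $I_w=I$. A maximal $w$-ideal is a (nonzero) proper $w$-ideal of $E$ that is not properly contained in any proper $w$-ideal of $E$. $E$ has finite $w$-character if every nonzero nonunit element of $E$ is contained in only finitely many maximal $w$-ideals of $E$. *)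

theory Defs
  imports "HOL-Computational_Algebra.Polynomial_Factorial"
begin

text \<open>
  An integral domain \<open>E\<close> is represented as a subring of an ambient field \<open>'k\<close>; its quotient field
  \<open>L\<close> is then the set of quotients of elements of \<open>E\<close> in \<open>'k\<close>. This allows \<open>D\<close> and \<open>D[X]\<^sub>A\<close> to be
  treated by the same definitions, with \<open>D\<close> the image of an arbitrary type of class \<open>idom\<close> in its
  fraction field and \<open>D[X]\<^sub>A\<close> a subring of the fraction field of \<open>D[X]\<close>.
\<close>

definition is_subring :: "'k::field set \<Rightarrow> bool" where
  "is_subring E \<longleftrightarrow> 1 \<in> E \<and> (\<forall>x\<in>E. \<forall>y\<in>E. x - y \<in> E \<and> x * y \<in> E)"

definition quot_field :: "'k::field set \<Rightarrow> 'k set" where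
  "quot_field E = {a / b | a b. a \<in> E \<and> b \<in> E \<and> b \<noteq> 0}"

text \<open>Closure under additive inverses follows from closure under multiplication by \<open>-1 \<in> E\<close>.
  The zero ideal is admitted here and excluded explicitly below.\<close>

definition fractional_ideal :: "'k::field set \<Rightarrow> 'k set \<Rightarrow> bool" where
  "fractional_ideal E I \<longleftrightarrow>
     I \<subseteq> quot_field E \<and> 0 \<in> I \<and>
     (\<forall>x\<in>I. \<forall>y\<in>I. x + y \<in> I) \<and> (\<forall>e\<in>E. \<forall>x\<in>I. e * x \<in> I) \<and>
     (\<exists>d\<in>E. d \<noteq> 0 \<and> (\<forall>x\<in>I. d * x \<in> E))"

definition ideal_generated_by :: "'k::field set \<Rightarrow> 'k set \<Rightarrow> 'k set" where
  "ideal_generated_by E S = {\<Sum>s\<in>S. c s * s | c. \<forall>s\<in>S. c s \<in> E}"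

definition finitely_generated_ideal :: "'k::field set \<Rightarrow> 'k set \<Rightarrow> bool" where
  "finitely_generated_ideal E J \<longleftrightarrow> (\<exists>S. finite S \<and> S \<subseteq> E \<and> J = ideal_generated_by E S)"

definition ideal_inverse :: "'k::field set \<Rightarrow> 'k set \<Rightarrow> 'k set" where
  "ideal_inverse E I = {a \<in> quot_field E. \<forall>x\<in>I. a * x \<in> E}"

definition v_closure :: "'k::field set \<Rightarrow> 'k set \<Rightarrow> 'k set" where
  "v_closure E I = ideal_inverse E (ideal_inverse E I)"

definition GV :: "'k::field set \<Rightarrow> 'k set set" where
  "GV E = {J. finitely_generated_ideal E J \<and> J \<noteq> {0} \<and> v_closure E J = E}"

definition w_closure :: "'k::field set \<Rightarrow> 'k set \<Rightarrow> 'k set" where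
  "w_closure E I = {x \<in> quot_field E. \<exists>J\<in>GV E. \<forall>y\<in>J. x * y \<in> I}"

definition w_ideal :: "'k::field set \<Rightarrow> 'k set \<Rightarrow> bool" where
  "w_ideal E I \<longleftrightarrow> fractional_ideal E I \<and> I \<noteq> {0} \<and> w_closure E I = I"

definition maximal_w_ideal :: "'k::field set \<Rightarrow> 'k set \<Rightarrow> bool" where
  "maximal_w_ideal E M \<longleftrightarrow>
     w_ideal E M \<and> M \<subset> E \<and> \<not> (\<exists>I. w_ideal E I \<and> I \<subset> E \<and> M \<subset> I)"

definition finite_w_character :: "'k::field set \<Rightarrow> bool" where
  "finite_w_character E \<longleftrightarrow>
     (\<forall>x\<in>E. x \<noteq> 0 \<and> \<not> (\<exists>y\<in>E. x * y = 1) \<longrightarrow> finite {M. maximal_w_ideal E M \<and> x \<in> M})"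

definition base_ring :: "'a::idom fract set" where
  "base_ring = range to_fract"

definition anderson_set :: "'a::idom poly set" where
  "anderson_set = {f. poly f 0 = 1}"

definition anderson_ring :: "'a::idom poly fract set" where
  "anderson_ring = {to_fract f / to_fract g | f g. g \<in> anderson_set}"

lemma anderson_set_nonzero: "g \<in> anderson_set \<Longrightarrow> g \<noteq> 0"
  by (auto simp: anderson_set_def)

lemma is_subring_base_ring: "is_subring base_ring"
proof -
  have "1 \<in> range to_fract" by (metis rangeI to_fract_1)
  moreover have "to_fract a - to_fract b \<in> range to_fract" for a b :: 'a
    by (metis rangeI to_fract_diff)
  moreover have "to_fract a * to_fract b \<in> range to_fract" for a b :: 'a
    by (metis rangeI to_fract_mult)
  ultimately show ?thesis by (auto simp: is_subring_def base_ring_def)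
qed

lemma is_subring_anderson_ring: "is_subring (anderson_ring :: 'a::idom poly fract set)"
proof -
  have one: "(1 :: 'a poly) \<in> anderson_set" by (simp add: anderson_set_def)
  have mult: "g * h \<in> anderson_set" if "g \<in> anderson_set" "h \<in> anderson_set" for g h :: "'a poly"
    using that by (simp add: anderson_set_def)
  have "x - y \<in> anderson_ring \<and> x * y \<in> anderson_ring"
    if mem: "x \<in> anderson_ring" "y \<in> anderson_ring" for x y :: "'a poly fract"
  proof -
    obtain f g where x: "x = to_fract f / to_fract g" and g: "g \<in> anderson_set"
      using mem(1) by (auto simp: anderson_ring_def)
    obtain p q where y: "y = to_fract p / to_fract q" and q: "q \<in> anderson_set"
      using mem(2) by (auto simp: anderson_ring_def)
    have "x - y = to_fract (f * q - p * g) / to_fract (g * q)"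
      using anderson_set_nonzero[OF g] anderson_set_nonzero[OF q]
      by (simp add: x y diff_frac_eq)
    moreover have "x * y = to_fract (f * p) / to_fract (g * q)" by (simp add: x y)
    ultimately show ?thesis using mult[OF g q] unfolding anderson_ring_def by blast
  qed
  moreover have "1 \<in> (anderson_ring :: 'a poly fract set)"
    unfolding anderson_ring_def using one by (force intro!: exI[of _ 1])
  ultimately show ?thesis by (auto simp: is_subring_def)
qed

lemma quot_field_base_ring: "quot_field base_ring = UNIV"
proof -
  have "x \<in> quot_field base_ring" for x :: "'a fract"
  proof (cases x rule: Fract_cases)
    case (Fract a b)
    then show ?thesis
      unfolding quot_field_def base_ring_def Fract_conv_to_fract by force
  qed
  then show ?thesis by blast
qed

lemma quot_field_anderson_ring: "quot_field (anderson_ring :: 'a::idom poly fract set) = UNIV"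
proof -
  have poly: "to_fract f \<in> anderson_ring" for f :: "'a poly"
  proof -
    have "to_fract f = to_fract f / to_fract 1" "(1 :: 'a poly) \<in> anderson_set"
      by (simp_all add: anderson_set_def)
    then show ?thesis unfolding anderson_ring_def by blast
  qed
  have "x \<in> quot_field anderson_ring" for x :: "'a poly fract"
  proof (cases x rule: Fract_cases)
    case (Fract a b)
    then show ?thesis
      unfolding quot_field_def Fract_conv_to_fract using poly by force
  qed
  then show ?thesis by blast
qed

end

theory Submission
  imports Defs
begin

text \<open>
  Write \<open>R\<close> for the Anderson ring \<open>D[X]\<^sub>A\<close>. The maximal \<open>w\<close>-ideals of \<open>R\<close> are of two kinds.

  Those that contain a nonzero constant are exactly the extensions \<open>M[X]\<^sub>A\<close> of the maximal \<open>w\<close>-ideals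
  \<open>M\<close> of \<open>D\<close> (\<open>maximal_w_ideal_extension\<close>, \<open>maximal_w_ideal_meeting_base_ring\<close>), and different \<open>M\<close>
  have different extensions because elements of \<open>A\<close> have constant term \<open>1\<close>: a constant of \<open>M[X]\<^sub>A\<close>
  lies in \<open>M\<close>. Two facts carry this correspondence. Extending a \<open>w\<close>-ideal of \<open>D\<close> gives a
  \<open>w\<close>-ideal of \<open>R\<close> (\<open>w_closed_extension\<close>). Conversely, if \<open>Q\<close> is a proper \<open>w\<close>-ideal of \<open>R\<close> that
  contains a nonzero constant, then the ideal of all coefficients of polynomials in \<open>Q\<close> has a proper
  \<open>w\<close>-closure \<open>W\<close> (\<open>proper_w_coeff_ideal\<close>), so that \<open>Q\<close> lies in the proper \<open>w\<close>-ideal \<open>W[X]\<^sub>A\<close>.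
  Applied to the ideals above a given one, these two statements transport maximality in both
  directions.

  Both facts compare the coefficients of a product \<open>f * h\<close> with those of the factors. The
  Dedekind-Mertens formula would do this; the weaker \<open>coeff_power_mult_mem\<close>, that a power of each
  single coefficient of \<open>f\<close> sends \<open>h\<close> into any ideal containing the coefficients of \<open>f * h\<close>,
  suffices, because replacing the generators of a Glaz-Vasconcelos ideal by powers again gives
  a Glaz-Vasconcelos ideal (\<open>gv_set_powers\<close>).

  The maximal \<open>w\<close>-ideals \<open>Q\<close> of \<open>R\<close> without nonzero constants are prime, hence correspond to
  prime ideals of \<open>D[X]\<close> that lie over \<open>0\<close>, and these are contracted from \<open>K[X]\<close>, with \<open>K\<close> the
  quotient field of \<open>D\<close>. A nonzero polynomial lies in only finitely many of them
  (\<open>finite_maximal_w_ideals_over_zero\<close>).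

  So let \<open>D\<close> have finite \<open>w\<close>-character and let \<open>f \<noteq> 0\<close> be a polynomial. Besides finitely many ideals
  over \<open>0\<close>, it lies only in ideals \<open>M[X]\<^sub>A\<close> for which \<open>M\<close> contains the leading coefficient of \<open>f\<close>, and
  there are finitely many of these. Conversely, a nonunit of \<open>D\<close> is a nonunit of \<open>R\<close>, and it lies
  in \<open>M[X]\<^sub>A\<close> for each maximal \<open>w\<close>-ideal \<open>M\<close> of \<open>D\<close> that contains it.
\<close>


section \<open>The w-operation through generating sets\<close>

definition submodule :: "'k::field set \<Rightarrow> 'k set \<Rightarrow> bool" where
  "submodule E I \<longleftrightarrow> 0 \<in> I \<and> (\<forall>x\<in>I. \<forall>y\<in>I. x + y \<in> I) \<and> (\<forall>e\<in>E. \<forall>x\<in>I. e * x \<in> I)"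

text \<open>
  A finite generating set of a Glaz-Vasconcelos ideal: \<open>J\<^sub>v = E\<close> says that \<open>J\<inverse> = E\<close>, and
  whether \<open>u\<close> lies in \<open>J\<inverse>\<close> can be tested on generators of \<open>J\<close>. The nonzero element excludes \<open>{}\<close> and
  \<open>{0}\<close> in the case of a field \<open>E\<close>.
\<close>

definition gv_set :: "'k::field set \<Rightarrow> 'k set \<Rightarrow> bool" where
  "gv_set E S \<longleftrightarrow> finite S \<and> S \<subseteq> E \<and> (\<exists>s\<in>S. s \<noteq> 0) \<and> (\<forall>u. (\<forall>s\<in>S. u * s \<in> E) \<longrightarrow> u \<in> E)"

definition w_closed :: "'k::field set \<Rightarrow> 'k set \<Rightarrow> bool" where
  "w_closed E I \<longleftrightarrow> (\<forall>x S. gv_set E S \<longrightarrow> (\<forall>s\<in>S. x * s \<in> I) \<longrightarrow> x \<in> I)"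

text \<open>
  The proper integral \<open>w\<close>-ideals of \<open>E\<close>, with the zero ideal admitted.
\<close>

definition proper_w :: "'k::field set \<Rightarrow> 'k set \<Rightarrow> bool" where
  "proper_w E I \<longleftrightarrow> submodule E I \<and> I \<subseteq> E \<and> w_closed E I \<and> 1 \<notin> I"

lemma submoduleD:
  assumes "submodule E I"
  shows "0 \<in> I" "x \<in> I \<Longrightarrow> y \<in> I \<Longrightarrow> x + y \<in> I" "e \<in> E \<Longrightarrow> x \<in> I \<Longrightarrow> e * x \<in> I"
  using assms unfolding submodule_def by blast+

lemma submodule_sum:
  assumes "submodule E I" "\<And>s. s \<in> S \<Longrightarrow> f s \<in> I"
  shows "(\<Sum>s\<in>S. f s) \<in> I"
  using assms(2)
proof (induction S rule: infinite_finite_induct)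
  case (insert t S)
  then show ?case using submoduleD(2)[OF assms(1), of "f t" "sum f S"] by simp
qed (simp_all add: submoduleD(1)[OF assms(1)])

lemma gv_setD:
  assumes "gv_set E S"
  shows "finite S" "S \<subseteq> E" "\<exists>s\<in>S. s \<noteq> 0" "(\<And>s. s \<in> S \<Longrightarrow> u * s \<in> E) \<Longrightarrow> u \<in> E"
  using assms unfolding gv_set_def by blast+

lemma w_closedD: "w_closed E I \<Longrightarrow> gv_set E S \<Longrightarrow> (\<And>s. s \<in> S \<Longrightarrow> x * s \<in> I) \<Longrightarrow> x \<in> I"
  by (auto simp: w_closed_def)

lemma proper_wD:
  assumes "proper_w E I"
  shows "submodule E I" "I \<subseteq> E" "w_closed E I" "1 \<notin> I"
  using assms by (auto simp: proper_w_def)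

locale domain_in_field =
  fixes E :: "'k::field set"
  assumes subring: "is_subring E" and quot: "quot_field E = UNIV"
begin

lemma one_mem: "1 \<in> E" and diff_mem: "x \<in> E \<Longrightarrow> y \<in> E \<Longrightarrow> x - y \<in> E"
  and mult_mem: "x \<in> E \<Longrightarrow> y \<in> E \<Longrightarrow> x * y \<in> E"
  using subring unfolding is_subring_def by blast+

lemma zero_mem: "0 \<in> E"
  using diff_mem[OF one_mem one_mem] by simp

lemma add_mem: "x \<in> E \<Longrightarrow> y \<in> E \<Longrightarrow> x + y \<in> E"
  using diff_mem[of x "0 - y"] diff_mem[of 0 y] zero_mem by simp

lemma submodule_self: "submodule E E"
  by (simp add: submodule_def zero_mem add_mem mult_mem)

lemma generator_mem: "s \<in> ideal_generated_by E S" if "finite S" "s \<in> S"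
proof -
  have "(\<Sum>t\<in>S. (if t = s then 1 else 0) * t) = s"
    using that by (simp add: if_distrib[of "\<lambda>c. c * _"] sum.delta cong: if_cong)
  then show ?thesis unfolding ideal_generated_by_def
    using one_mem zero_mem by (intro CollectI exI[of _ "\<lambda>t. if t = s then 1 else 0"]) auto
qed

lemma mult_generated_mem_iff:
  assumes "finite S" "submodule E I"
  shows "(\<forall>y\<in>ideal_generated_by E S. x * y \<in> I) \<longleftrightarrow> (\<forall>s\<in>S. x * s \<in> I)"
proof
  assume "\<forall>s\<in>S. x * s \<in> I"
  then have "c s * (x * s) \<in> I" if "s \<in> S" "\<forall>s\<in>S. c s \<in> E" for c s
    using that submoduleD(3)[OF assms(2)] by blast
  then have "(\<Sum>s\<in>S. c s * (x * s)) \<in> I" if "\<forall>s\<in>S. c s \<in> E" for c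
    using that by (intro submodule_sum[OF assms(2)])
  moreover have "x * (\<Sum>s\<in>S. c s * s) = (\<Sum>s\<in>S. c s * (x * s))" for c
    by (simp add: sum_distrib_left mult.left_commute)
  ultimately show "\<forall>y\<in>ideal_generated_by E S. x * y \<in> I"
    by (auto simp: ideal_generated_by_def)
qed (use generator_mem[OF assms(1)] in blast)

text \<open>
  Let \<open>H\<close> be the inverse of the ideal, so \<open>E \<subseteq> H\<close>. If \<open>1 \<in> H\<inverse>\<close> then \<open>H \<subseteq> E\<close>, and otherwise nothing
  but \<open>H = E\<close> has to be inverted.
\<close>

lemma v_closure_generated_eq_iff:
  assumes "finite S" "S \<subseteq> E"
  shows "v_closure E (ideal_generated_by E S) = E \<longleftrightarrow> (\<forall>u. (\<forall>s\<in>S. u * s \<in> E) \<longrightarrow> u \<in> E)"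
proof -
  define H where "H = ideal_inverse E (ideal_generated_by E S)"
  have H: "H = {u. \<forall>s\<in>S. u * s \<in> E}"
    by (simp add: H_def ideal_inverse_def quot mult_generated_mem_iff[OF assms(1) submodule_self])
  have EH: "E \<subseteq> H" using assms(2) by (auto simp: H intro: mult_mem)
  have "ideal_inverse E H = E \<longleftrightarrow> H \<subseteq> E"
  proof
    assume eq: "ideal_inverse E H = E"
    have "1 \<in> ideal_inverse E H" using eq one_mem by simp
    then show "H \<subseteq> E" by (auto simp: ideal_inverse_def)
  next
    assume "H \<subseteq> E"
    with EH have "H = E" by simp
    then show "ideal_inverse E H = E"
      using one_mem by (auto simp: ideal_inverse_def quot mult_mem dest!: bspec[of _ _ 1])
  qed
  then show ?thesis by (auto simp: v_closure_def H_def[symmetric] H)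
qed

lemma GV_iff: "J \<in> GV E \<longleftrightarrow> (\<exists>S. gv_set E S \<and> J = ideal_generated_by E S)"
proof -
  have "ideal_generated_by E S = {0} \<longleftrightarrow> (\<forall>s\<in>S. s = 0)" if "finite S" for S
  proof
    assume "\<forall>s\<in>S. s = 0"
    then have "(\<Sum>s\<in>S. c s * s) = 0" for c by (simp add: sum.neutral)
    then show "ideal_generated_by E S = {0}"
      unfolding ideal_generated_by_def using zero_mem by (auto intro!: exI[of _ "\<lambda>_. 0"])
  qed (use generator_mem[OF that] in blast)
  then have gv: "gv_set E S \<longleftrightarrow> (finite S \<and> S \<subseteq> E) \<and>
      ideal_generated_by E S \<noteq> {0} \<and> v_closure E (ideal_generated_by E S) = E" for S
    by (cases "finite S \<and> S \<subseteq> E") (auto simp: gv_set_def v_closure_generated_eq_iff)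
  show ?thesis
    unfolding GV_def finitely_generated_ideal_def gv by auto
qed

lemma w_closure_eq:
  assumes "submodule E I"
  shows "w_closure E I = {x. \<exists>S. gv_set E S \<and> (\<forall>s\<in>S. x * s \<in> I)}"
proof -
  have "(\<exists>J\<in>GV E. \<forall>y\<in>J. x * y \<in> I) \<longleftrightarrow> (\<exists>S. gv_set E S \<and> (\<forall>y\<in>ideal_generated_by E S. x * y \<in> I))" for x
    by (auto simp: Bex_def GV_iff)
  moreover have "(\<exists>S. gv_set E S \<and> (\<forall>y\<in>ideal_generated_by E S. x * y \<in> I)) \<longleftrightarrow>
      (\<exists>S. gv_set E S \<and> (\<forall>s\<in>S. x * s \<in> I))" for x
    using mult_generated_mem_iff[OF gv_setD(1) assms] by (simp cong: conj_cong)
  ultimately show ?thesis by (simp add: w_closure_def quot)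
qed

lemma gv_set_one: "gv_set E {1}"
  by (simp add: gv_set_def one_mem)

text \<open>
  If \<open>u\<close> multiplies all products \<open>s * t\<close> into \<open>E\<close>, then \<open>u * s\<close> multiplies \<open>T s\<close> into \<open>E\<close>, so
  \<open>u * s \<in> E\<close> for each \<open>s\<close>, so \<open>u \<in> E\<close>. Letting \<open>T\<close> depend on \<open>s\<close> gives the idempotence of the
  \<open>w\<close>-closure; a constant \<open>T\<close> gives its additivity.
\<close>

lemma gv_set_products:
  assumes "gv_set E S" "\<And>s. s \<in> S \<Longrightarrow> gv_set E (T s)"
  shows "gv_set E (\<Union>s\<in>S. (*) s ` T s)"
  unfolding gv_set_def
proof (intro conjI allI impI)
  show "finite (\<Union>s\<in>S. (*) s ` T s)" using gv_setD(1)[OF assms(1)] gv_setD(1)[OF assms(2)] by simp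
  show "(\<Union>s\<in>S. (*) s ` T s) \<subseteq> E"
    using gv_setD(2)[OF assms(1)] gv_setD(2)[OF assms(2)] by (blast intro: mult_mem)
  obtain s t where "s \<in> S" "s \<noteq> 0" "t \<in> T s" "t \<noteq> 0"
    using gv_setD(3)[OF assms(1)] gv_setD(3)[OF assms(2)] by blast
  then show "\<exists>r\<in>\<Union>s\<in>S. (*) s ` T s. r \<noteq> 0"
    by (intro bexI[of _ "s * t"]) auto
next
  fix u assume u: "\<forall>r\<in>\<Union>s\<in>S. (*) s ` T s. u * r \<in> E"
  have "u * s \<in> E" if "s \<in> S" for s
    by (rule gv_setD(4)[OF assms(2)[OF that]]) (use that u in \<open>auto simp: mult.assoc\<close>)
  then show "u \<in> E" by (rule gv_setD(4)[OF assms(1)])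
qed

lemma subset_w_closure: "submodule E I \<Longrightarrow> I \<subseteq> w_closure E I"
  using gv_set_one by (force simp: w_closure_eq)

lemma submodule_w_closure:
  assumes I: "submodule E I"
  shows "submodule E (w_closure E I)"
  unfolding submodule_def
proof (intro conjI ballI)
  show "0 \<in> w_closure E I" using subset_w_closure[OF I] submoduleD(1)[OF I] by blast
next
  fix x y assume "x \<in> w_closure E I" "y \<in> w_closure E I"
  then obtain S T where S: "gv_set E S" "\<forall>s\<in>S. x * s \<in> I" and T: "gv_set E T" "\<forall>s\<in>T. y * s \<in> I"
    by (auto simp: w_closure_eq[OF I])
  have "(x + y) * (s * t) \<in> I" if "s \<in> S" "t \<in> T" for s t
  proof -
    have "t * (x * s) + s * (y * t) \<in> I"
      using that S T gv_setD(2) by (metis subsetD submoduleD(2,3)[OF I])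
    then show ?thesis by (simp add: algebra_simps)
  qed
  then show "x + y \<in> w_closure E I"
    using gv_set_products[OF S(1), of "\<lambda>_. T"] T(1)
    by (auto simp: w_closure_eq[OF I] intro!: exI[of _ "\<Union>s\<in>S. (*) s ` T"])
next
  fix e x assume "e \<in> E" "x \<in> w_closure E I"
  then show "e * x \<in> w_closure E I"
    using submoduleD(3)[OF I] by (auto simp: w_closure_eq[OF I] mult.assoc)
qed

lemma w_closed_w_closure:
  assumes I: "submodule E I"
  shows "w_closed E (w_closure E I)"
  unfolding w_closed_def
proof (intro allI impI)
  fix x S assume S: "gv_set E S" and "\<forall>s\<in>S. x * s \<in> w_closure E I"
  then have "\<forall>s\<in>S. \<exists>T. gv_set E T \<and> (\<forall>t\<in>T. x * s * t \<in> I)" by (auto simp: w_closure_eq[OF I])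
  then obtain T where T: "\<And>s. s \<in> S \<Longrightarrow> gv_set E (T s)" "\<And>s t. s \<in> S \<Longrightarrow> t \<in> T s \<Longrightarrow> x * s * t \<in> I"
    by metis
  then show "x \<in> w_closure E I"
    using gv_set_products[OF S, of T]
    by (auto simp: w_closure_eq[OF I] mult.assoc intro!: exI[of _ "\<Union>s\<in>S. (*) s ` T s"])
qed

lemma w_closure_subset_ring:
  assumes "submodule E I" "I \<subseteq> E"
  shows "w_closure E I \<subseteq> E"
proof
  fix x assume "x \<in> w_closure E I"
  then obtain S where "gv_set E S" "\<forall>s\<in>S. x * s \<in> I" by (auto simp: w_closure_eq[OF assms(1)])
  then show "x \<in> E" using assms(2) by (meson gv_setD(4) subsetD)
qed

lemma w_closure_eq_self_iff:
  assumes "submodule E I"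
  shows "w_closure E I = I \<longleftrightarrow> w_closed E I"
proof
  assume "w_closed E I"
  then have "w_closure E I \<subseteq> I" unfolding w_closure_eq[OF assms] w_closed_def by blast
  with subset_w_closure[OF assms] show "w_closure E I = I" by simp
qed (metis assms w_closed_w_closure)

lemma proper_w_w_closure:
  "submodule E I \<Longrightarrow> I \<subseteq> E \<Longrightarrow> 1 \<notin> w_closure E I \<Longrightarrow> proper_w E (w_closure E I)"
  by (simp add: proper_w_def submodule_w_closure w_closed_w_closure w_closure_subset_ring)

lemma w_ideal_psubset_iff: "w_ideal E I \<and> I \<subset> E \<longleftrightarrow> proper_w E I \<and> I \<noteq> {0}"
proof -
  have "fractional_ideal E I \<longleftrightarrow> submodule E I" if "I \<subseteq> E"
    using that one_mem by (auto simp: fractional_ideal_def submodule_def quot intro!: bexI[of _ 1])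
  moreover have "I = E" if "submodule E I" "I \<subseteq> E" "1 \<in> I"
    using that submoduleD(3)[OF that(1) _ that(3)] by auto
  ultimately show ?thesis
    using one_mem w_closure_eq_self_iff[of I] unfolding w_ideal_def proper_w_def psubset_eq by metis
qed

lemma maximal_w_ideal_iff:
  "maximal_w_ideal E M \<longleftrightarrow> proper_w E M \<and> M \<noteq> {0} \<and> (\<forall>I. proper_w E I \<longrightarrow> M \<subseteq> I \<longrightarrow> I = M)"
proof -
  have "I \<noteq> {0}" if "proper_w E M" "M \<noteq> {0}" "M \<subseteq> I" for I
    using that submoduleD(1)[OF proper_wD(1)[OF that(1)]] by auto
  then show ?thesis unfolding maximal_w_ideal_def using w_ideal_psubset_iff by (metis psubset_eq)
qed

lemma submodule_colon: "submodule E {z. a * z \<in> I}" if "submodule E I"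
  using submoduleD[OF that] by (auto simp: submodule_def distrib_left mult.left_commute)

text \<open>
  The colon ideal \<open>{z \<in> E. y * z \<in> M}\<close> is \<open>w\<close>-closed, contains \<open>M\<close>, and contains \<open>x \<notin> M\<close>. By
  maximality it is not proper, so it contains \<open>1\<close>.
\<close>

lemma maximal_w_ideal_prime:
  assumes M: "maximal_w_ideal E M" and xy: "x \<in> E" "y \<in> E" "x * y \<in> M" and x: "x \<notin> M"
  shows "y \<in> M"
proof -
  define I where "I = {z \<in> E. y * z \<in> M}"
  have pM: "proper_w E M" and max: "\<And>I. proper_w E I \<Longrightarrow> M \<subseteq> I \<Longrightarrow> I = M"
    using M by (auto simp: maximal_w_ideal_iff)
  note M = proper_wD[OF pM]
  have "submodule E I"
    using submodule_colon[OF M(1), of y] submodule_self by (auto simp: I_def submodule_def)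
  moreover have "w_closed E I"
    unfolding w_closed_def
  proof (intro allI impI)
    fix z S assume S: "gv_set E S" and z: "\<forall>s\<in>S. z * s \<in> I"
    have "z \<in> E" by (rule gv_setD(4)[OF S]) (use z in \<open>simp add: I_def\<close>)
    moreover have "y * z \<in> M"
      by (rule w_closedD[OF M(3) S]) (use z in \<open>simp add: I_def mult.assoc\<close>)
    ultimately show "z \<in> I" by (simp add: I_def)
  qed
  moreover have "M \<subseteq> I" using M(2) xy(2) submoduleD(3)[OF M(1)] by (auto simp: I_def)
  moreover have "x \<in> I" using xy by (simp add: I_def mult.commute)
  ultimately have "1 \<in> I" using max[of I] x by (auto simp: proper_w_def I_def)
  then show ?thesis by (simp add: I_def)
qed

lemma w_closed_principal:
  assumes "c \<noteq> 0"
  shows "w_closed E ((*) c ` E)"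
  unfolding w_closed_def
proof (intro allI impI)
  fix x S assume S: "gv_set E S" and x: "\<forall>s\<in>S. x * s \<in> (*) c ` E"
  have "x / c \<in> E"
    by (rule gv_setD(4)[OF S]) (use x assms in auto)
  then show "x \<in> (*) c ` E"
    using assms by (intro image_eqI[of _ _ "x / c"]) auto
qed

lemma submodule_principal: "submodule E ((*) c ` E)"
proof -
  have "c * x + c * y \<in> (*) c ` E" "e * (c * x) \<in> (*) c ` E" if "x \<in> E" "y \<in> E" "e \<in> E" for x y e
    using that image_eqI[of "c * x + c * y" "(*) c" "x + y" E]
      image_eqI[of "e * (c * x)" "(*) c" "e * x" E] add_mem mult_mem
    by (simp_all add: distrib_left)
  then show ?thesis using zero_mem by (force simp: submodule_def)
qed

text \<open>
  Powers of the generators of a Glaz-Vasconcelos ideal again generate one; the exponents here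
  may depend on the generator. The generators are replaced by their powers one at a time: once
  \<open>x * t ^ (k + 1) \<in> I\<close> for the new generator \<open>t\<close>, the element \<open>x * t ^ k\<close> needs only the first power
  of \<open>t\<close>, so the induction hypothesis applies to it, and \<open>k\<close> descends to \<open>0\<close>.
\<close>

lemma gv_set_powers:
  assumes S: "gv_set E S" and I: "submodule E I" "w_closed E I"
    and x: "\<And>s. s \<in> S \<Longrightarrow> \<exists>N::nat. x * s ^ N \<in> I"
  shows "x \<in> I"
proof -
  have "x \<in> I" if "finite S'" "S' \<subseteq> S" "\<forall>s\<in>S'. \<exists>N. x * s ^ N \<in> I" "\<forall>s\<in>S - S'. x * s \<in> I" for S' x
    using that
  proof (induction S' arbitrary: x rule: finite_induct)
    case empty
    then show ?case using w_closedD[OF I(2) S, of x] by simp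
  next
    case (insert t S')
    have step: "y \<in> I" if y: "y = x * t ^ k" "y * t \<in> I" for y k
    proof (rule insert.IH)
      have pow: "t ^ k \<in> E"
        using insert.prems gv_setD(2)[OF S] by (induction k) (auto simp: one_mem mult_mem)
      have up: "y * z \<in> I" if "x * z \<in> I" for z
        using submoduleD(3)[OF I(1) pow that] by (simp add: y(1) ac_simps)
      show "\<forall>s\<in>S'. \<exists>N. y * s ^ N \<in> I" using insert.prems up by blast
      show "\<forall>s\<in>S - S'. y * s \<in> I" using insert.prems up y(2) by blast
    qed (use insert.prems in auto)
    obtain N where N: "x * t ^ N \<in> I" using insert.prems by blast
    then show ?case
    proof (induction N)
      case (Suc N)
      then show ?case using step[of _ N] by (simp add: ac_simps)
    qed simp
  qed
  from this[of S x] show ?thesis using x gv_setD(1)[OF S] by blast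
qed

end

section \<open>A weak form of the Dedekind-Mertens lemma\<close>

text \<open>
  Induction on \<open>f\<close>, working modulo the polynomials with coefficients in \<open>T\<close>. For the constant term
  \<open>a\<close> of \<open>a + X * f\<close>, the congruence \<open>a * h \<equiv> - X * f * h\<close> yields
  \<open>a ^ n * h \<equiv> (- X * f) ^ n * h\<close>, whose coefficients below degree \<open>n\<close> vanish; so \<open>n > degree h\<close>
  will do. For a coefficient \<open>c\<close> of \<open>f\<close>, a second induction lowers the exponent \<open>n\<close> in
  \<open>a ^ n * h \<equiv> 0\<close>: at the cost of a power of \<open>c\<close> one may assume \<open>a * h \<equiv> 0\<close>, and then
  \<open>f * h \<equiv> 0\<close>, so the hypothesis on \<open>f\<close> finishes.
\<close>

lemma coeff_power_mult_mem:
  fixes f h :: "'a::comm_ring_1 poly"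
  assumes T: "0 \<in> T" "\<And>x y. x \<in> T \<Longrightarrow> y \<in> T \<Longrightarrow> x + y \<in> T" "\<And>c x. x \<in> T \<Longrightarrow> c * x \<in> T"
    and fh: "\<And>k. coeff (f * h) k \<in> T"
  shows "\<exists>N. \<forall>k. coeff f i ^ N * coeff h k \<in> T"
  using fh
proof (induction f arbitrary: h i)
  case 0
  show ?case by (rule exI[of _ 1]) (simp add: T(1))
next
  case (pCons a f)
  have T_diff: "x - y \<in> T" if "x \<in> T" "y \<in> T" for x y
    using T(2)[OF that(1) T(3)[OF that(2), of "-1"]] by simp
  have T_sum: "(\<Sum>i\<in>A. g i) \<in> T" if "\<And>i. i \<in> A \<Longrightarrow> g i \<in> T" for A :: "nat set" and g
    using that by (induction A rule: infinite_finite_induct) (auto intro: T)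
  have a: "\<exists>N. \<forall>k. a ^ N * coeff h k \<in> T"
  proof (intro exI allI)
    fix k
    define n where "n = Suc (degree h)"
    \<comment> \<open>The polynomial \<open>y\<close> is \<open>- X * f\<close>, and \<open>a - y\<close> divides \<open>a ^ n - y ^ n\<close>.\<close>
    define y where "y = - pCons 0 f"
    define w where "w = (\<Sum>j<n. y ^ (n - Suc j) * [:a:] ^ j)"
    have "[:a:] ^ n - y ^ n = pCons a f * w"
      using power_diff_sumr2[of "[:a:]" n y] by (simp add: w_def y_def)
    then have "([:a:] ^ n - y ^ n) * h = w * (pCons a f * h)"
      by (simp only: mult.assoc mult.commute mult.left_commute)
    then have "[:a ^ n:] * h = y ^ n * h + w * (pCons a f * h)"
      by (simp only: left_diff_distrib poly_const_pow diff_eq_eq add.commute)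
    then have "coeff ([:a ^ n:] * h) k = coeff (y ^ n * h) k + coeff (w * (pCons a f * h)) k"
      by simp
    then have eq: "a ^ n * coeff h k = coeff (y ^ n * h) k + coeff (w * (pCons a f * h)) k"
      by simp
    have "y = monom 1 1 * (- f)" by (simp add: y_def monom_altdef)
    then have "y ^ n * h = monom 1 n * ((- f) ^ n * h)"
      by (simp only: power_mult_distrib monom_power mult.assoc power_one mult_1)
    then have y0: "coeff (y ^ n * h) k = 0" if "k < n" using that by (simp add: coeff_monom_mult)
    have "coeff (w * (pCons a f * h)) k \<in> T"
      unfolding coeff_mult[of w] by (intro T_sum T(3) pCons.prems)
    then show "a ^ Suc (degree h) * coeff h k \<in> T"
      using eq y0 T(1) by (cases "k < n") (auto simp: n_def coeff_eq_0)
  qed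
  show ?case
  proof (cases i)
    case 0
    then show ?thesis using a by simp
  next
    case (Suc j)
    define c where "c = coeff f j"
    have "\<exists>M. \<forall>k. c ^ M * coeff g k \<in> T"
      if "\<And>k. coeff (pCons a f * g) k \<in> T" "\<And>k. a ^ n * coeff g k \<in> T" for n g
      using that
    proof (induction n arbitrary: g)
      case 0
      then show ?case by (intro exI[of _ 0]) simp
    next
      case (Suc n)
      have "\<exists>M. \<forall>k. c ^ M * coeff (smult a g) k \<in> T"
      proof (rule Suc.IH)
        show "coeff (pCons a f * smult a g) k \<in> T" for k
          using T(3)[OF Suc.prems(1)[of k], of a] by (simp only: mult_smult_right coeff_smult)
        show "a ^ n * coeff (smult a g) k \<in> T" for k
          using Suc.prems(2)[of k] by (simp add: ac_simps)
      qed
      then obtain M where M: "\<And>k. c ^ M * (a * coeff g k) \<in> T" by auto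
      have "coeff (f * smult (c ^ M) g) k \<in> T" for k
      proof -
        have "coeff (f * smult (c ^ M) g) k
          = c ^ M * coeff (pCons a f * g) (Suc k) - c ^ M * (a * coeff g (Suc k))"
          by (simp add: algebra_simps)
        then show ?thesis by (simp only: T_diff[OF T(3)[OF Suc.prems(1)] M])
      qed
      from pCons.IH[OF this, of j] obtain N where "\<And>k. c ^ N * (c ^ M * coeff g k) \<in> T"
        by (auto simp: c_def)
      then show ?case by (intro exI[of _ "N + M"]) (simp add: power_add mult.assoc)
    qed
    with a pCons.prems show ?thesis by (metis Suc c_def coeff_pCons_Suc)
  qed
qed

section \<open>Extension of ideals to the Anderson ring\<close>

interpretation base: domain_in_field "base_ring :: 'a::idom fract set"
  by unfold_locales (simp_all add: is_subring_base_ring quot_field_base_ring)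

interpretation anderson: domain_in_field "anderson_ring :: 'a::idom poly fract set"
  by unfold_locales (simp_all add: is_subring_anderson_ring quot_field_anderson_ring)

abbreviation frac_const :: "'a::idom \<Rightarrow> 'a poly fract" where
  "frac_const a \<equiv> to_fract [:a:]"

text \<open>
  The ideal \<open>I[X]\<close> of \<open>D[X]\<close>; \<open>extension I\<close> is its localization \<open>I[X]\<^sub>A\<close>.
\<close>

definition polys_over :: "'a::idom fract set \<Rightarrow> 'a poly set" where
  "polys_over I = {f. \<forall>k. to_fract (coeff f k) \<in> I}"

definition extension :: "'a::idom fract set \<Rightarrow> 'a poly fract set" where
  "extension I = {to_fract f / to_fract g | f g. f \<in> polys_over I \<and> g \<in> anderson_set}"

text \<open>
  The sum of the content ideals of the polynomials in \<open>Q\<close>. It is closed under addition, since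
  two coefficients can be moved to the same degree by multiplying with powers of \<open>X\<close>.
\<close>

definition coeff_ideal :: "'a::idom poly fract set \<Rightarrow> 'a fract set" where
  "coeff_ideal Q = {to_fract (coeff f k) | f k. to_fract f \<in> Q}"

lemma to_fract_power: "to_fract (a ^ n) = to_fract a ^ n"
  by (induction n) simp_all

lemma mem_base_ring: "to_fract a \<in> base_ring"
  by (simp add: base_ring_def)

lemma anderson_set_one: "1 \<in> anderson_set"
  and anderson_set_mult: "g \<in> anderson_set \<Longrightarrow> h \<in> anderson_set \<Longrightarrow> g * h \<in> anderson_set"
  by (simp_all add: anderson_set_def)

lemma extension_memI: "f \<in> polys_over I \<Longrightarrow> g \<in> anderson_set \<Longrightarrow> to_fract f / to_fract g \<in> extension I"
  unfolding extension_def by blast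

lemma extension_memE:
  assumes "x \<in> extension I"
  obtains f g where "x = to_fract f / to_fract g" "f \<in> polys_over I" "g \<in> anderson_set"
  using assms unfolding extension_def by blast

lemma poly_mem_extension: "f \<in> polys_over I \<Longrightarrow> to_fract f \<in> extension I"
  using extension_memI[OF _ anderson_set_one] by fastforce

lemma extension_base_ring: "extension base_ring = anderson_ring"
  by (simp add: extension_def anderson_ring_def polys_over_def mem_base_ring)

lemma poly_mem_anderson_ring: "to_fract f \<in> anderson_ring"
  using poly_mem_extension[of f base_ring] by (simp add: extension_base_ring polys_over_def mem_base_ring)

lemma inverse_mem_anderson_ring: "g \<in> anderson_set \<Longrightarrow> inverse (to_fract g) \<in> anderson_ring"
  unfolding anderson_ring_def by (intro CollectI exI[of _ 1] exI[of _ g]) (simp add: inverse_eq_divide)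

lemma polys_over_add:
  assumes "submodule base_ring I" "f \<in> polys_over I" "g \<in> polys_over I"
  shows "f + g \<in> polys_over I"
  using assms by (simp add: polys_over_def submoduleD(2))

lemma polys_over_mult:
  assumes "submodule base_ring I" "f \<in> polys_over I"
  shows "g * f \<in> polys_over I"
proof -
  have "to_fract (coeff (g * f) k) \<in> I" for k
    unfolding coeff_mult to_fract_sum to_fract_mult
    by (intro submodule_sum[OF assms(1)] submoduleD(3)[OF assms(1)] mem_base_ring)
      (use assms(2) in \<open>auto simp: polys_over_def\<close>)
  then show ?thesis by (simp add: polys_over_def)
qed

text \<open>
  A denominator \<open>g\<close> has constant term \<open>1\<close>, so \<open>c\<close> is the constant term of \<open>c * g\<close>. In particular
  \<open>I\<close> can be recovered from its extension.
\<close>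

lemma const_mem_extension_iff:
  assumes "submodule base_ring I"
  shows "frac_const c \<in> extension I \<longleftrightarrow> to_fract c \<in> I"
proof
  assume "frac_const c \<in> extension I"
  then obtain f g where fg: "frac_const c = to_fract f / to_fract g" "f \<in> polys_over I" "g \<in> anderson_set"
    by (rule extension_memE)
  then have "to_fract ([:c:] * g) = to_fract f"
    unfolding to_fract_mult using anderson_set_nonzero[of g] by (simp add: field_simps)
  then have "f = [:c:] * g" by (simp only: to_fract_eq_iff)
  then have "coeff f 0 = c"
    using fg(3) by (simp add: anderson_set_def poly_0_coeff_0)
  then show "to_fract c \<in> I" using fg(2) by (auto simp: polys_over_def)
next
  assume "to_fract c \<in> I"
  then show "frac_const c \<in> extension I"
    using submoduleD(1)[OF assms]
    by (intro poly_mem_extension) (auto simp: polys_over_def coeff_pCons split: nat.split)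
qed

text \<open>
  Again by comparing constant terms; this is \<open>K \<inter> D[X]\<^sub>A = D\<close> for the quotient field \<open>K\<close> of \<open>D\<close>.
\<close>

lemma const_mem_anderson_ring_iff: "to_fract c / to_fract d \<in> base_ring
    \<longleftrightarrow> frac_const c / frac_const d \<in> anderson_ring" if "d \<noteq> 0"
proof
  assume "to_fract c / to_fract d \<in> base_ring"
  then obtain e where "to_fract c / to_fract d = to_fract e" by (auto simp: base_ring_def)
  then have "to_fract c = to_fract (e * d)" using that by (simp add: field_simps)
  then have "[:c:] = [:e:] * [:d:]" by (simp only: to_fract_eq_iff) (simp add: mult.commute)
  then have "frac_const c = frac_const e * frac_const d" by (simp only: to_fract_mult)
  then have "frac_const c / frac_const d = frac_const e" using that by (simp add: field_simps)
  then show "frac_const c / frac_const d \<in> anderson_ring" by (simp add: poly_mem_anderson_ring)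
next
  assume "frac_const c / frac_const d \<in> anderson_ring"
  then obtain f g where fg: "frac_const c / frac_const d = to_fract f / to_fract g" "g \<in> anderson_set"
    by (auto simp: anderson_ring_def)
  then have "to_fract ([:c:] * g) = to_fract ([:d:] * f)"
    using that anderson_set_nonzero[of g] by (simp only: to_fract_mult) (simp add: field_simps)
  then have "[:c:] * g = [:d:] * f" by (simp only: to_fract_eq_iff)
  then have "poly ([:c:] * g) 0 = poly ([:d:] * f) 0" by simp
  then have "c = d * poly f 0" using fg(2) by (simp add: anderson_set_def)
  then show "to_fract c / to_fract d \<in> base_ring" using that by (simp add: mem_base_ring)
qed

lemma submodule_extension:
  assumes I: "submodule base_ring I"
  shows "submodule anderson_ring (extension I)"
  unfolding submodule_def
proof (intro conjI ballI)
  show "0 \<in> extension I"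
    using poly_mem_extension[of 0 I] submoduleD(1)[OF I] by (simp add: polys_over_def)
next
  fix x y assume "x \<in> extension I" "y \<in> extension I"
  then obtain f g p q where x: "x = to_fract f / to_fract g" "f \<in> polys_over I" "g \<in> anderson_set"
    and y: "y = to_fract p / to_fract q" "p \<in> polys_over I" "q \<in> anderson_set"
    by (metis extension_memE)
  then have "x + y = to_fract (q * f + g * p) / to_fract (g * q)"
    using anderson_set_nonzero[OF x(3)] anderson_set_nonzero[OF y(3)] by (simp add: field_simps)
  then show "x + y \<in> extension I"
    using x y by (simp only:) (intro extension_memI polys_over_add polys_over_mult anderson_set_mult I)
next
  fix e x :: "'a poly fract" assume "e \<in> anderson_ring" "x \<in> extension I"
  then obtain f g p q where e: "e = to_fract f / to_fract g" "g \<in> anderson_set"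
    and x: "x = to_fract p / to_fract q" "p \<in> polys_over I" "q \<in> anderson_set"
    by (auto simp: anderson_ring_def elim!: extension_memE)
  then have "e * x = to_fract (f * p) / to_fract (g * q)" by simp
  then show "e * x \<in> extension I"
    using e x by (simp only:) (intro extension_memI polys_over_mult anderson_set_mult I)
qed

lemma extension_mono: "I \<subseteq> I' \<Longrightarrow> extension I \<subseteq> extension I'"
  by (fastforce simp: extension_def polys_over_def)

lemma common_denominator:
  assumes I: "submodule base_ring I" and "finite S" "\<And>s. s \<in> S \<Longrightarrow> x s \<in> extension I"
  shows "\<exists>g\<in>anderson_set. \<forall>s\<in>S. \<exists>p\<in>polys_over I. x s * to_fract g = to_fract p"
  using assms(2,3)
proof (induction S rule: finite_induct)
  case empty
  then show ?case using anderson_set_one by blast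
next
  case (insert t S)
  then obtain g where g: "g \<in> anderson_set" "\<forall>s\<in>S. \<exists>p\<in>polys_over I. x s * to_fract g = to_fract p" by auto
  obtain f h where t: "x t = to_fract f / to_fract h" "f \<in> polys_over I" "h \<in> anderson_set"
    using insert.prems by (meson extension_memE insertI1)
  show ?case
  proof (rule bexI[of _ "g * h"], rule ballI)
    fix s assume s: "s \<in> insert t S"
    show "\<exists>p\<in>polys_over I. x s * to_fract (g * h) = to_fract p"
    proof (cases "s = t")
      case True
      have "x t * to_fract (g * h) = to_fract (g * f)"
        using t anderson_set_nonzero[of h] by simp
      then show ?thesis using True polys_over_mult[OF I t(2)] by metis
    next
      case False
      then obtain p where p: "p \<in> polys_over I" "x s * to_fract g = to_fract p" using g(2) s by auto
      then have "x s * to_fract (g * h) = to_fract (h * p)"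
        by (simp flip: mult.assoc add: mult.commute)
      then show ?thesis using polys_over_mult[OF I p(1)] by metis
    qed
  qed (intro anderson_set_mult g(1) t(3))
qed

corollary common_denominator_anderson_ring:
  assumes "finite S" "\<And>s. s \<in> S \<Longrightarrow> x s \<in> anderson_ring"
  shows "\<exists>g\<in>anderson_set. \<forall>s\<in>S. \<exists>p. x s * to_fract g = to_fract p"
  using common_denominator[OF base.submodule_self assms(1), of x] assms(2)
  unfolding extension_base_ring by blast

text \<open>
  If \<open>u\<close> in the quotient field of \<open>D\<close> multiplies all coefficients of the polynomials \<open>p s\<close> into
  \<open>D\<close>, then it multiplies the generators \<open>s\<close> into the Anderson ring, hence lies in the Anderson
  ring, hence in \<open>D\<close>.
\<close>

lemma gv_set_coefficients:
  assumes S: "gv_set anderson_ring S"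
    and g: "g \<in> anderson_set" and p: "\<And>s. s \<in> S \<Longrightarrow> s * to_fract g = to_fract (p s)"
  shows "gv_set base_ring (\<Union>s\<in>S. (\<lambda>k. to_fract (coeff (p s) k)) ` {..degree (p s)})"
    (is "gv_set _ ?C")
  unfolding gv_set_def
proof (intro conjI allI impI)
  note g0 = anderson_set_nonzero[OF g]
  show "finite ?C" using gv_setD(1)[OF S] by simp
  show "?C \<subseteq> base_ring" by (auto simp: mem_base_ring)
  obtain s where s: "s \<in> S" "s \<noteq> 0" using gv_setD(3)[OF S] by blast
  then have "p s \<noteq> 0" using p[OF s(1)] g0 by auto
  then have "to_fract (coeff (p s) (degree (p s))) \<noteq> 0" by simp
  then show "\<exists>c\<in>?C. c \<noteq> 0" using s(1) by blast
next
  note g0 = anderson_set_nonzero[OF g]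
  fix u :: "'a fract" assume u: "\<forall>c\<in>?C. u * c \<in> base_ring"
  obtain b a where ba: "u = to_fract b / to_fract a" "a \<noteq> 0"
    by (cases u rule: Fract_cases) (auto simp: Fract_conv_to_fract)
  have "frac_const b / frac_const a \<in> anderson_ring"
  proof (rule gv_setD(4)[OF S])
    fix s assume s: "s \<in> S"
    have "[:a:] dvd [:b:] * p s"
      unfolding const_poly_dvd_iff
    proof
      fix k
      show "a dvd coeff ([:b:] * p s) k"
      proof (cases "k \<le> degree (p s)")
        case True
        then have "u * to_fract (coeff (p s) k) \<in> base_ring" using u s by blast
        then obtain e where "u * to_fract (coeff (p s) k) = to_fract e" by (auto simp: base_ring_def)
        then have "to_fract (b * coeff (p s) k) = to_fract (a * e)"
          using ba by (simp add: field_simps)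
        then have "b * coeff (p s) k = a * e" by (simp only: to_fract_eq_iff)
        then show ?thesis by simp
      qed (simp add: coeff_eq_0)
    qed
    then obtain q where "[:b:] * p s = [:a:] * q" by (elim dvdE)
    then have "frac_const b * to_fract (p s) = frac_const a * to_fract q"
      by (simp only: to_fract_mult[symmetric])
    then have "frac_const b / frac_const a * s = to_fract q / to_fract g"
      unfolding p[OF s, symmetric] using ba(2) g0 by (simp add: field_simps)
    then show "frac_const b / frac_const a * s \<in> anderson_ring"
      using g by (auto simp: anderson_ring_def)
  qed
  then show "u \<in> base_ring" using const_mem_anderson_ring_iff ba by blast
qed

text \<open>
  Up to denominators from \<open>A\<close>, which are units, \<open>x\<close> is a polynomial \<open>h\<close> and the generators in \<open>S\<close>
  are polynomials \<open>p s\<close>, with all products \<open>p s * h\<close> in \<open>I[X]\<close>. By the weak Dedekind-Mertens lemma,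
  powers of the coefficients of the \<open>p s\<close> multiply \<open>h\<close> into \<open>I[X]\<close>; since these coefficients
  generate a Glaz-Vasconcelos ideal of \<open>D\<close>, so do the powers, and \<open>h\<close> itself lies in \<open>I[X]\<close>.
\<close>

lemma w_closed_extension:
  assumes I: "submodule base_ring I" "I \<subseteq> base_ring" "w_closed base_ring I"
  shows "w_closed anderson_ring (extension I)"
  unfolding w_closed_def
proof (intro allI impI)
  fix x S assume S: "gv_set anderson_ring S" and x: "\<forall>s\<in>S. x * s \<in> extension I"
  have "extension I \<subseteq> anderson_ring"
    using extension_mono[OF I(2)] by (simp add: extension_base_ring)
  then have "x * s \<in> anderson_ring" if "s \<in> S" for s using x that by blast
  then have "x \<in> anderson_ring" by (rule gv_setD(4)[OF S])
  then obtain f g where fg: "x = to_fract f / to_fract g" "g \<in> anderson_set"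
    by (auto simp: anderson_ring_def)
  obtain d where d: "d \<in> anderson_set" and "\<forall>s\<in>S. \<exists>p. s * to_fract d = to_fract p"
    using common_denominator_anderson_ring[OF gv_setD(1)[OF S], of "\<lambda>s. s"] gv_setD(2)[OF S] by blast
  then obtain p where p: "\<And>s. s \<in> S \<Longrightarrow> s * to_fract d = to_fract (p s)"
    by metis
  obtain e where e: "e \<in> anderson_set" and "\<forall>s\<in>S. \<exists>k\<in>polys_over I. x * s * to_fract e = to_fract k"
    using common_denominator[OF I(1) gv_setD(1)[OF S], of "\<lambda>s. x * s"] x by blast
  then obtain k where k: "\<And>s. s \<in> S \<Longrightarrow> k s \<in> polys_over I"
    "\<And>s. s \<in> S \<Longrightarrow> x * s * to_fract e = to_fract (k s)"
    by metis
  define h where "h = f * e"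
  have x_eq: "x = to_fract h / to_fract (g * e)"
    using fg(1) anderson_set_nonzero[OF e] by (simp add: h_def)
  have "to_fract (coeff h n) \<in> I" for n
  proof (rule base.gv_set_powers[OF gv_set_coefficients[OF S d p] I(1,3)])
    fix c assume "c \<in> (\<Union>s\<in>S. (\<lambda>k. to_fract (coeff (p s) k)) ` {..degree (p s)})"
    then obtain s i where s: "s \<in> S" and c: "c = to_fract (coeff (p s) i)" by blast
    have "to_fract (p s * h) = to_fract (d * g * k s)"
      unfolding h_def to_fract_mult p[OF s, symmetric] k(2)[OF s, symmetric] fg(1)
      using anderson_set_nonzero[OF fg(2)] by (simp add: field_simps)
    then have "p s * h = d * g * k s" by (simp only: to_fract_eq_iff)
    then have "p s * h \<in> polys_over I" using polys_over_mult[OF I(1) k(1)[OF s]] by simp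
    then have "\<exists>N. \<forall>n. coeff (p s) i ^ N * coeff h n \<in> {a. to_fract a \<in> I}"
      using submoduleD(1,2)[OF I(1)] submoduleD(3)[OF I(1) mem_base_ring]
      by (intro coeff_power_mult_mem) (simp_all add: polys_over_def)
    then show "\<exists>N. to_fract (coeff h n) * c ^ N \<in> I"
      by (auto simp: c to_fract_power mult.commute)
  qed
  then show "x \<in> extension I"
    unfolding x_eq by (intro extension_memI anderson_set_mult fg(2) e) (simp add: polys_over_def)
qed

lemma proper_w_extension: "proper_w anderson_ring (extension I)" if "proper_w base_ring I"
proof -
  note I = proper_wD[OF that]
  have "1 \<notin> extension I"
    using const_mem_extension_iff[OF I(1), of 1] I(4) by (simp flip: one_pCons)
  then show ?thesis
    using submodule_extension[OF I(1)] w_closed_extension[OF I(1-3)] extension_mono[OF I(2)]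
    by (simp add: proper_w_def extension_base_ring)
qed

section \<open>Maximal w-ideals meeting the base ring\<close>

lemma submodule_coeff_ideal:
  assumes Q: "submodule anderson_ring Q"
  shows "submodule base_ring (coeff_ideal Q)"
  unfolding submodule_def
proof (intro conjI ballI)
  show "0 \<in> coeff_ideal Q"
    unfolding coeff_ideal_def using submoduleD(1)[OF Q] by (force intro!: exI[of _ 0])
next
  fix x y assume "x \<in> coeff_ideal Q" "y \<in> coeff_ideal Q"
  then obtain f i g j where x: "x = to_fract (coeff f i)" "to_fract f \<in> Q"
    and y: "y = to_fract (coeff g j)" "to_fract g \<in> Q" by (auto simp: coeff_ideal_def)
  have "to_fract (monom 1 j * f + monom 1 i * g) \<in> Q"
    unfolding to_fract_add to_fract_mult
    by (intro submoduleD(2,3)[OF Q] poly_mem_anderson_ring x y)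
  moreover have "x + y = to_fract (coeff (monom 1 j * f + monom 1 i * g) (i + j))"
    by (simp add: x y coeff_monom_mult)
  ultimately show "x + y \<in> coeff_ideal Q" unfolding coeff_ideal_def by blast
next
  fix e x :: "'a fract" assume "e \<in> base_ring" "x \<in> coeff_ideal Q"
  then obtain a f i where x: "e = to_fract a" "x = to_fract (coeff f i)" "to_fract f \<in> Q"
    by (auto simp: coeff_ideal_def base_ring_def)
  have "to_fract ([:a:] * f) \<in> Q"
    unfolding to_fract_mult by (intro submoduleD(3)[OF Q] poly_mem_anderson_ring x)
  moreover have "e * x = to_fract (coeff ([:a:] * f) i)" by (simp add: x)
  ultimately show "e * x \<in> coeff_ideal Q" unfolding coeff_ideal_def by blast
qed

lemma coeff_ideal_subset_base_ring: "coeff_ideal Q \<subseteq> base_ring"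
  by (auto simp: coeff_ideal_def mem_base_ring)

lemma fraction_mem_iff:
  assumes Q: "submodule anderson_ring Q" and g: "g \<in> anderson_set"
  shows "to_fract f / to_fract g \<in> Q \<longleftrightarrow> to_fract f \<in> Q"
proof
  assume "to_fract f / to_fract g \<in> Q"
  from submoduleD(3)[OF Q poly_mem_anderson_ring[of g] this] show "to_fract f \<in> Q"
    using anderson_set_nonzero[OF g] by simp
next
  assume "to_fract f \<in> Q"
  from submoduleD(3)[OF Q inverse_mem_anderson_ring[OF g] this] show "to_fract f / to_fract g \<in> Q"
    by (simp add: divide_inverse mult.commute)
qed

lemma subset_extension_coeff_ideal:
  assumes Q: "submodule anderson_ring Q" "Q \<subseteq> anderson_ring" and I: "coeff_ideal Q \<subseteq> I"
  shows "Q \<subseteq> extension I"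
proof
  fix x assume x: "x \<in> Q"
  then obtain f g where fg: "x = to_fract f / to_fract g" "g \<in> anderson_set"
    using Q(2) by (auto simp: anderson_ring_def)
  then have "to_fract f \<in> Q" using x fraction_mem_iff[OF Q(1)] by simp
  then have "f \<in> polys_over I" using I by (auto simp: coeff_ideal_def polys_over_def)
  then show "x \<in> extension I" using fg extension_memI by blast
qed

text \<open>
  Let \<open>u\<close> multiply the constant \<open>a\<close> and the polynomials \<open>f s\<close> into the Anderson ring. The constant
  forces \<open>u\<close> to be, up to a unit, of the form \<open>h / a\<close> with a polynomial \<open>h\<close>, and then \<open>a\<close> divides
  every \<open>f s * h\<close>. By the weak Dedekind-Mertens lemma for the principal ideal of \<open>a\<close>, powers of
  the elements of \<open>S\<close>, which occur as coefficients of the \<open>f s\<close>, multiply \<open>h\<close> into \<open>a * D[X]\<close>; as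
  \<open>S\<close> generates a Glaz-Vasconcelos ideal, \<open>a\<close> divides \<open>h\<close>.
\<close>

lemma gv_set_polynomials:
  assumes S: "gv_set base_ring S" and a: "a \<noteq> 0"
    and f: "\<And>s. s \<in> S \<Longrightarrow> \<exists>k. s = to_fract (coeff (f s) k)"
  shows "gv_set anderson_ring (insert (frac_const a) ((\<lambda>s. to_fract (f s)) ` S))" (is "gv_set _ ?T")
  unfolding gv_set_def
proof (intro conjI allI impI)
  show "finite ?T" using gv_setD(1)[OF S] by simp
  show "?T \<subseteq> anderson_ring" by (auto simp: poly_mem_anderson_ring)
  show "\<exists>t\<in>?T. t \<noteq> 0" using a by auto
  fix u assume u: "\<forall>t\<in>?T. u * t \<in> anderson_ring"
  obtain g where g: "g \<in> anderson_set" and "\<forall>t\<in>?T. \<exists>p. u * t * to_fract g = to_fract p"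
    using common_denominator_anderson_ring[OF \<open>finite ?T\<close>, of "\<lambda>t. u * t"] u by blast
  then obtain p where p: "\<And>t. t \<in> ?T \<Longrightarrow> u * t * to_fract g = to_fract (p t)"
    by metis
  define h where "h = p (frac_const a)"
  have h: "u * frac_const a * to_fract g = to_fract h" using p[of "frac_const a"] by (simp add: h_def)
  have "to_fract (coeff h n) \<in> (*) (to_fract a) ` base_ring" for n
  proof (rule base.gv_set_powers[OF S base.submodule_principal base.w_closed_principal])
    show "to_fract a \<noteq> 0" using a by simp
    fix s assume s: "s \<in> S"
    then obtain i where i: "s = to_fract (coeff (f s) i)" using f by blast
    have "to_fract (f s * h) = to_fract ([:a:] * p (to_fract (f s)))"
      unfolding to_fract_mult h[symmetric] using p[of "to_fract (f s)"] s by (simp add: ac_simps)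
    then have "f s * h = [:a:] * p (to_fract (f s))" by (simp only: to_fract_eq_iff)
    then have "\<exists>N. \<forall>n. coeff (f s) i ^ N * coeff h n \<in> {b. a dvd b}"
      by (intro coeff_power_mult_mem) auto
    then obtain N where "a dvd coeff (f s) i ^ N * coeff h n" by auto
    then obtain b where "coeff (f s) i ^ N * coeff h n = a * b" by (elim dvdE)
    then have "to_fract (coeff h n) * s ^ N = to_fract a * to_fract b"
      by (metis i mult.commute to_fract_mult to_fract_power)
    then show "\<exists>N. to_fract (coeff h n) * s ^ N \<in> (*) (to_fract a) ` base_ring"
      using mem_base_ring by blast
  qed
  then have "a dvd coeff h n" for n
    by (auto simp: image_iff base_ring_def dvd_def simp flip: to_fract_mult)
  then obtain q where q: "h = [:a:] * q" by (metis const_poly_dvd_iff dvdE)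
  have "u = to_fract q / to_fract g"
    using h a anderson_set_nonzero[OF g] unfolding q to_fract_mult by (simp add: field_simps)
  then show "u \<in> anderson_ring" using g by (auto simp: anderson_ring_def)
qed

text \<open>
  If \<open>1\<close> were in the \<open>w\<close>-closure, finitely many coefficients of polynomials in \<open>Q\<close> would generate
  a Glaz-Vasconcelos ideal of \<open>D\<close>. Then these polynomials together with \<open>a\<close> would generate a
  Glaz-Vasconcelos ideal inside \<open>Q\<close>, and \<open>1\<close> would belong to the \<open>w\<close>-ideal \<open>Q\<close>.
\<close>

lemma proper_w_coeff_ideal:
  assumes Q: "proper_w anderson_ring Q" and a: "a \<noteq> 0" "frac_const a \<in> Q"
  shows "proper_w base_ring (w_closure base_ring (coeff_ideal Q))"
proof (rule base.proper_w_w_closure)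
  note Q = proper_wD[OF Q]
  show sub: "submodule base_ring (coeff_ideal Q)" by (rule submodule_coeff_ideal[OF Q(1)])
  show "coeff_ideal Q \<subseteq> base_ring" by (rule coeff_ideal_subset_base_ring)
  show "1 \<notin> w_closure base_ring (coeff_ideal Q)"
  proof
    assume "1 \<in> w_closure base_ring (coeff_ideal Q)"
    then obtain S where S: "gv_set base_ring S" "S \<subseteq> coeff_ideal Q"
      by (auto simp: base.w_closure_eq[OF sub])
    then have "\<forall>s\<in>S. \<exists>f k. s = to_fract (coeff f k) \<and> to_fract f \<in> Q"
      by (auto simp: coeff_ideal_def)
    then obtain f where f: "\<And>s. s \<in> S \<Longrightarrow> \<exists>k. s = to_fract (coeff (f s) k)" "\<And>s. s \<in> S \<Longrightarrow> to_fract (f s) \<in> Q"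
      by metis
    from w_closedD[OF Q(3) gv_set_polynomials[OF S(1) a(1) f(1)], of 1] f(2) a(2) Q(4)
    show False by auto
  qed
qed

text \<open>
  For a proper \<open>w\<close>-ideal \<open>Q\<close> above \<open>M[X]\<^sub>A\<close>, the \<open>w\<close>-closure of its coefficient ideal is a proper
  \<open>w\<close>-ideal above \<open>M\<close>, hence equal to \<open>M\<close>; so all coefficients of polynomials in \<open>Q\<close> lie in \<open>M\<close>.
\<close>

lemma maximal_w_ideal_extension:
  assumes M: "maximal_w_ideal base_ring M"
  shows "maximal_w_ideal anderson_ring (extension M)"
proof -
  have pM: "proper_w base_ring M" and M0: "M \<noteq> {0}"
    and max: "\<And>I. proper_w base_ring I \<Longrightarrow> M \<subseteq> I \<Longrightarrow> I = M"
    using M by (auto simp: base.maximal_w_ideal_iff)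
  note Msub = proper_wD(1)[OF pM]
  obtain a where a: "to_fract a \<in> M" "a \<noteq> 0"
  proof -
    obtain x where "x \<in> M" "x \<noteq> 0" using M0 submoduleD(1)[OF Msub] by blast
    moreover then obtain a where "x = to_fract a" using proper_wD(2)[OF pM] by (auto simp: base_ring_def)
    ultimately show ?thesis using that by auto
  qed
  have aE: "frac_const a \<in> extension M" using a(1) const_mem_extension_iff[OF Msub] by simp
  have "Q = extension M" if Q: "proper_w anderson_ring Q" "extension M \<subseteq> Q" for Q
  proof -
    have "M \<subseteq> coeff_ideal Q"
    proof
      fix x assume x: "x \<in> M"
      then obtain c where c: "x = to_fract c" using proper_wD(2)[OF pM] by (auto simp: base_ring_def)
      then have "frac_const c \<in> Q" using x Q(2) const_mem_extension_iff[OF Msub] by auto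
      then show "x \<in> coeff_ideal Q" unfolding coeff_ideal_def c
        by (intro CollectI exI[of _ "[:c:]"] exI[of _ 0]) simp
    qed
    moreover note cl = base.subset_w_closure[OF submodule_coeff_ideal[OF proper_wD(1)[OF Q(1)]]]
    ultimately have "w_closure base_ring (coeff_ideal Q) = M"
      using proper_w_coeff_ideal[OF Q(1) a(2)] aE Q(2) by (intro max) auto
    then have "Q \<subseteq> extension M"
      using subset_extension_coeff_ideal[OF proper_wD(1,2)[OF Q(1)]] cl by simp
    then show ?thesis using Q(2) by simp
  qed
  moreover have "extension M \<noteq> {0}" using aE a(2) by auto
  ultimately show ?thesis
    using proper_w_extension[OF pM] by (simp add: anderson.maximal_w_ideal_iff)
qed

text \<open>
  The ideal \<open>M\<close> is the \<open>w\<close>-closure of the coefficient ideal of \<open>Q\<close>: its extension is proper and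
  contains \<open>Q\<close>, hence equals \<open>Q\<close>, and a larger proper \<open>w\<close>-ideal of \<open>D\<close> would have a larger proper
  extension.
\<close>

lemma maximal_w_ideal_meeting_base_ring:
  assumes Q: "maximal_w_ideal anderson_ring Q" and a: "a \<noteq> 0" "frac_const a \<in> Q"
  shows "\<exists>M. maximal_w_ideal base_ring M \<and> coeff_ideal Q \<subseteq> M \<and> Q = extension M"
proof -
  have pQ: "proper_w anderson_ring Q"
    and max: "\<And>I. proper_w anderson_ring I \<Longrightarrow> Q \<subseteq> I \<Longrightarrow> I = Q"
    using Q by (auto simp: anderson.maximal_w_ideal_iff)
  note Qsub = proper_wD(1)[OF pQ]
  define M where "M = w_closure base_ring (coeff_ideal Q)"
  have CM: "coeff_ideal Q \<subseteq> M"
    unfolding M_def by (rule base.subset_w_closure[OF submodule_coeff_ideal[OF Qsub]])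
  have pM: "proper_w base_ring M"
    unfolding M_def by (rule proper_w_coeff_ideal[OF pQ a])
  have QM: "Q = extension M"
    using max[OF proper_w_extension[OF pM]] subset_extension_coeff_ideal[OF proper_wD(1,2)[OF pQ] CM] by simp
  have "I = M" if I: "proper_w base_ring I" "M \<subseteq> I" for I
  proof -
    have "extension I = extension M"
      using max[OF proper_w_extension[OF I(1)]] extension_mono[OF I(2)] QM by simp
    then have "to_fract c \<in> I \<longleftrightarrow> to_fract c \<in> M" for c
      using const_mem_extension_iff proper_wD(1)[OF pM] proper_wD(1)[OF I(1)] by metis
    then show ?thesis
      using proper_wD(2)[OF pM] proper_wD(2)[OF I(1)] by (auto simp: base_ring_def)
  qed
  moreover have "to_fract a \<in> M"
    using a(2) QM const_mem_extension_iff[OF proper_wD(1)[OF pM]] by simp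
  then have "M \<noteq> {0}" using a(1) by auto
  ultimately have "maximal_w_ideal base_ring M" using pM by (simp add: base.maximal_w_ideal_iff)
  then show ?thesis using CM QM by blast
qed

lemma inj_on_extension: "inj_on extension {M. maximal_w_ideal base_ring M}"
proof (rule inj_onI)
  fix M N :: "'a fract set"
  assume "M \<in> {M. maximal_w_ideal base_ring M}" "N \<in> {M. maximal_w_ideal base_ring M}"
    and eq: "extension M = extension N"
  then have "proper_w base_ring M" "proper_w base_ring N" by (auto simp: base.maximal_w_ideal_iff)
  note M = proper_wD[OF this(1)] and N = proper_wD[OF this(2)]
  have "to_fract c \<in> M \<longleftrightarrow> to_fract c \<in> N" for c
    using const_mem_extension_iff[OF M(1), of c] const_mem_extension_iff[OF N(1), of c] eq by simp
  then show "M = N" using M(2) N(2) by (auto simp: base_ring_def)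
qed

section \<open>Maximal w-ideals over zero\<close>

text \<open>
  The prime ideals of \<open>D[X]\<close> that meet \<open>D\<close> in \<open>0\<close>, that is, the zero ideal and the uppers to zero;
  that \<open>1\<close> is not a member is the case \<open>c = 1\<close> of the last condition.
\<close>

definition prime_over_zero :: "'a::idom poly set \<Rightarrow> bool" where
  "prime_over_zero P \<longleftrightarrow> 0 \<in> P \<and> (\<forall>f\<in>P. \<forall>g\<in>P. f + g \<in> P) \<and> (\<forall>f. \<forall>g\<in>P. f * g \<in> P) \<and>
     (\<forall>f g. f * g \<in> P \<longrightarrow> f \<in> P \<or> g \<in> P) \<and> (\<forall>c. [:c:] \<in> P \<longrightarrow> c = 0)"

lemma prime_over_zeroD:
  assumes "prime_over_zero P"
  shows "f \<in> P \<Longrightarrow> g \<in> P \<Longrightarrow> f + g \<in> P" "g \<in> P \<Longrightarrow> f * g \<in> P"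
    "f * g \<in> P \<Longrightarrow> f \<in> P \<or> g \<in> P" "[:c:] \<in> P \<Longrightarrow> c = 0"
  using assms unfolding prime_over_zero_def by blast+

text \<open>
  A nonzero polynomial of least degree in \<open>P\<close> generates \<open>P\<close> over the quotient field of \<open>D\<close>, by
  pseudo-division.
\<close>

lemma prime_over_zero_generator:
  assumes P: "prime_over_zero P" and f: "f \<in> P" "f \<noteq> 0"
  obtains p where "p \<in> P" "p \<noteq> 0" "\<And>g. g \<in> P \<Longrightarrow> \<exists>e q. e \<noteq> 0 \<and> smult e g = p * q"
proof -
  obtain p where p: "p \<in> P" "p \<noteq> 0" and min: "\<And>r. r \<in> P \<Longrightarrow> r \<noteq> 0 \<Longrightarrow> degree p \<le> degree r"
    using ex_has_least_nat[of "\<lambda>p. p \<in> P \<and> p \<noteq> 0" f degree] f by blast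
  have "\<exists>e q. e \<noteq> 0 \<and> smult e g = p * q" if g: "g \<in> P" for g
  proof -
    define e where "e = coeff p (degree p) ^ (Suc (degree g) - degree p)"
    obtain q r where qr: "pseudo_divmod g p = (q, r)" by (cases "pseudo_divmod g p")
    have eq: "smult e g = p * q + r" and r: "r = 0 \<or> degree r < degree p"
      using pseudo_divmod[OF p(2) qr] by (simp_all add: e_def)
    have "r = [:e:] * g + (- q) * p" using eq by (simp add: algebra_simps)
    then have "r \<in> P" using prime_over_zeroD(1,2)[OF P] g p(1) by metis
    then have "r = 0" using r min by fastforce
    moreover have "e \<noteq> 0" using p(2) by (simp add: e_def)
    ultimately show ?thesis using eq by auto
  qed
  with p show ?thesis by (rule that)
qed

text \<open>
  The hypothesis \<open>irred\<close> says that \<open>f\<close> has no factors of smaller degree over the quotient field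
  \<open>K\<close> other than constants. Then
  \<open>P = f * K[X] \<inter> D[X]\<close> is determined by \<open>f\<close>, because the generator of \<open>P\<close> divides \<open>f\<close> and is
  not constant, so differs from \<open>f\<close> by a constant factor.
\<close>

lemma prime_over_zero_eq_saturation:
  assumes P: "prime_over_zero P" and f: "f \<in> P" "f \<noteq> 0"
    and irred: "\<And>e g h. e \<noteq> 0 \<Longrightarrow> smult e f = g * h \<Longrightarrow> degree f \<le> degree g \<or> degree f \<le> degree h"
  shows "P = {g. \<exists>e. e \<noteq> 0 \<and> f dvd smult e g}"
proof (intro equalityI subsetI CollectI)
  obtain p where p: "p \<in> P" "p \<noteq> 0" and gen: "\<And>g. g \<in> P \<Longrightarrow> \<exists>e q. e \<noteq> 0 \<and> smult e g = p * q"
    using prime_over_zero_generator[OF P f] by blast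
  obtain e q where eq: "e \<noteq> 0" "smult e f = p * q" using gen[OF f(1)] by blast
  have "q \<noteq> 0" using eq f(2) by auto
  then have deg: "degree f = degree p + degree q"
    using eq degree_mult_eq[OF p(2), of q] by (metis degree_smult_eq)
  have "degree p \<noteq> 0"
  proof
    assume "degree p = 0"
    then obtain c where "p = [:c:]" by (rule degree_eq_zeroE)
    then show False using p prime_over_zeroD(4)[OF P] by auto
  qed
  then have "degree q = 0" using irred[OF eq] deg by auto
  then obtain c where c: "q = [:c:]" by (rule degree_eq_zeroE)
  then have cp: "smult e f = smult c p" "c \<noteq> 0" using eq \<open>q \<noteq> 0\<close> by auto
  fix g assume "g \<in> P"
  then obtain d k where d: "d \<noteq> 0" "smult d g = p * k" using gen by blast
  have "smult (c * d) g = smult c p * k" using d(2) by (simp flip: smult_smult)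
  also have "\<dots> = f * smult e k" by (simp flip: cp(1))
  finally show "\<exists>e. e \<noteq> 0 \<and> f dvd smult e g"
    using cp(2) d(1) by (intro exI[of _ "c * d"]) (metis dvd_triv_left mult_eq_0_iff)
next
  fix g assume "g \<in> {g. \<exists>e. e \<noteq> 0 \<and> f dvd smult e g}"
  then obtain e k where e: "e \<noteq> 0" "smult e g = f * k" by (auto elim!: dvdE)
  then have "[:e:] * g = k * f" by (simp add: mult.commute)
  then have "[:e:] * g \<in> P" using prime_over_zeroD(2)[OF P f(1)] by simp
  then show "g \<in> P" using prime_over_zeroD(3,4)[OF P] e(1) by blast
qed

text \<open>
  Induction on the degree. If \<open>f\<close> is, over the quotient field, a product of two factors of smaller
  degree, every prime containing \<open>f\<close> contains one of them; otherwise \<open>f\<close> determines the prime.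
\<close>

lemma finite_prime_over_zero: "f \<noteq> 0 \<Longrightarrow> finite {P. prime_over_zero P \<and> f \<in> P}"
proof (induction "degree f" arbitrary: f rule: less_induct)
  case less
  show ?case
  proof (cases "\<exists>e g h. e \<noteq> 0 \<and> smult e f = g * h \<and> degree g < degree f \<and> degree h < degree f")
    case True
    then obtain e g h where gh: "e \<noteq> 0" "smult e f = g * h" "degree g < degree f" "degree h < degree f"
      by blast
    then have "g \<noteq> 0" "h \<noteq> 0" using less.prems by auto
    moreover have "g \<in> P \<or> h \<in> P" if "prime_over_zero P" "f \<in> P" for P
      using prime_over_zeroD(2)[OF that, of "[:e:]"] gh(2) prime_over_zeroD(3)[OF that(1), of g h] by simp
    then have "{P. prime_over_zero P \<and> f \<in> P}
        \<subseteq> {P. prime_over_zero P \<and> g \<in> P} \<union> {P. prime_over_zero P \<and> h \<in> P}" by blast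
    ultimately show ?thesis
      using less.hyps[OF gh(3)] less.hyps[OF gh(4)] by (meson finite_UnI finite_subset)
  next
    case False
    then have "P = {g. \<exists>e. e \<noteq> 0 \<and> f dvd smult e g}" if "prime_over_zero P" "f \<in> P" for P
      using that less.prems by (intro prime_over_zero_eq_saturation) (auto simp: not_less)
    then have "{P. prime_over_zero P \<and> f \<in> P} \<subseteq> {{g. \<exists>e. e \<noteq> 0 \<and> f dvd smult e g}}" by blast
    then show ?thesis by (rule finite_subset) simp
  qed
qed

text \<open>
  Contraction to \<open>D[X]\<close> is injective on ideals of a localization, and maximal \<open>w\<close>-ideals are
  prime.
\<close>

lemma finite_maximal_w_ideals_over_zero:
  assumes "f \<noteq> (0 :: 'a::idom poly)"
  shows "finite {Q. maximal_w_ideal anderson_ring Q \<and> (\<forall>a. frac_const a \<in> Q \<longrightarrow> a = 0) \<and> to_fract f \<in> Q}"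
    (is "finite ?\<Q>")
proof (rule finite_imageD)
  define contraction :: "'a poly fract set \<Rightarrow> 'a poly set" where "contraction = (\<lambda>Q. {g. to_fract g \<in> Q})"
  have proper: "proper_w anderson_ring Q" if "Q \<in> ?\<Q>" for Q
    using that by (auto simp: anderson.maximal_w_ideal_iff)
  have "prime_over_zero (contraction Q)" if Q: "Q \<in> ?\<Q>" for Q
  proof -
    note sub = proper_wD(1)[OF proper[OF Q]]
    have "g \<in> contraction Q \<or> h \<in> contraction Q" if "g * h \<in> contraction Q" for g h
      using Q that anderson.maximal_w_ideal_prime[of Q "to_fract g" "to_fract h"] poly_mem_anderson_ring
      by (auto simp: contraction_def)
    then show ?thesis
      unfolding prime_over_zero_def
      using Q submoduleD(1,2)[OF sub] submoduleD(3)[OF sub poly_mem_anderson_ring]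
      by (simp add: contraction_def)
  qed
  then have "contraction ` ?\<Q> \<subseteq> {P. prime_over_zero P \<and> f \<in> P}"
    by (auto simp: contraction_def)
  then show "finite (contraction ` ?\<Q>)"
    using finite_prime_over_zero[OF assms] finite_subset by blast
  show "inj_on contraction ?\<Q>"
  proof (rule inj_onI)
    fix Q Q' assume Q: "Q \<in> ?\<Q>" "Q' \<in> ?\<Q>" and eq: "contraction Q = contraction Q'"
    note Qp = proper_wD(1,2)[OF proper[OF Q(1)]] and Qp' = proper_wD(1,2)[OF proper[OF Q(2)]]
    have "to_fract g / to_fract h \<in> Q \<longleftrightarrow> to_fract g / to_fract h \<in> Q'" if "h \<in> anderson_set" for g h
      using eq fraction_mem_iff[OF Qp(1) that] fraction_mem_iff[OF Qp'(1) that]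
      by (auto simp: contraction_def)
    then have "x \<in> Q \<longleftrightarrow> x \<in> Q'" if "x \<in> anderson_ring" for x
      using that by (auto simp: anderson_ring_def)
    then show "Q = Q'" using Qp(2) Qp'(2) by blast
  qed
qed

section \<open>Finite w-character\<close>

lemma finite_w_character_anderson_ring:
  assumes D: "finite_w_character (base_ring :: 'a::idom fract set)"
  shows "finite_w_character (anderson_ring :: 'a poly fract set)"
  unfolding finite_w_character_def
proof (intro ballI impI, elim conjE)
  fix x :: "'a poly fract" assume x: "x \<in> anderson_ring" "x \<noteq> 0"
  then obtain f g where fg: "x = to_fract f / to_fract g" "g \<in> anderson_set"
    by (auto simp: anderson_ring_def)
  have f0: "f \<noteq> 0" using x(2) fg(1) by auto
  \<comment> \<open>Any nonzero coefficient would do for \<open>c\<close>. If it is a unit, no proper ideal contains it.\<close>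
  define c where "c = lead_coeff f"
  have "finite {M. maximal_w_ideal base_ring M \<and> to_fract c \<in> M}"
  proof (cases "\<exists>y\<in>base_ring. to_fract c * y = 1")
    case True
    then obtain y where y: "y \<in> base_ring" "y * to_fract c = 1" by (auto simp: mult.commute)
    have "to_fract c \<notin> M" if "maximal_w_ideal base_ring M" for M
    proof -
      have "proper_w base_ring M" using that by (simp add: base.maximal_w_ideal_iff)
      then show ?thesis using submoduleD(3)[of base_ring M y "to_fract c"] y proper_wD by metis
    qed
    then have "{M. maximal_w_ideal base_ring M \<and> to_fract c \<in> M} = {}" by blast
    then show ?thesis by (simp only: finite.emptyI)
  next
    case False
    moreover have "to_fract c \<noteq> 0" using f0 by (simp add: c_def)
    ultimately show ?thesis using D mem_base_ring[of c] unfolding finite_w_character_def by blast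
  qed
  moreover have "{Q. maximal_w_ideal anderson_ring Q \<and> x \<in> Q} \<subseteq>
      {Q. maximal_w_ideal anderson_ring Q \<and> (\<forall>a. frac_const a \<in> Q \<longrightarrow> a = 0) \<and> to_fract f \<in> Q}
      \<union> extension ` {M. maximal_w_ideal base_ring M \<and> to_fract c \<in> M}" (is "_ \<subseteq> ?U \<union> ?V")
  proof
    fix Q assume "Q \<in> {Q. maximal_w_ideal anderson_ring Q \<and> x \<in> Q}"
    then have Q: "maximal_w_ideal anderson_ring Q" "x \<in> Q" by auto
    then have "submodule anderson_ring Q" by (auto simp: anderson.maximal_w_ideal_iff dest: proper_wD(1))
    then have fQ: "to_fract f \<in> Q" using Q(2) fraction_mem_iff fg by blast
    show "Q \<in> ?U \<union> ?V"
    proof (cases "\<forall>a. frac_const a \<in> Q \<longrightarrow> a = 0")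
      case False
      then obtain M where M: "maximal_w_ideal base_ring M" "coeff_ideal Q \<subseteq> M" "Q = extension M"
        using maximal_w_ideal_meeting_base_ring[OF Q(1)] by blast
      have "to_fract c \<in> coeff_ideal Q" using fQ unfolding coeff_ideal_def c_def by blast
      then show ?thesis using M by blast
    qed (use Q(1) fQ in blast)
  qed
  ultimately show "finite {Q. maximal_w_ideal anderson_ring Q \<and> x \<in> Q}"
    using finite_maximal_w_ideals_over_zero[OF f0] by (meson finite_UnI finite_imageI finite_subset)
qed

lemma finite_w_character_base_ring:
  assumes R: "finite_w_character (anderson_ring :: 'a::idom poly fract set)"
  shows "finite_w_character (base_ring :: 'a fract set)"
  unfolding finite_w_character_def
proof (intro ballI impI, elim conjE)
  fix x :: "'a fract" assume x: "x \<in> base_ring" "x \<noteq> 0" and nonunit: "\<not> (\<exists>y\<in>base_ring. x * y = 1)"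
  obtain c where c: "x = to_fract c" using x(1) by (auto simp: base_ring_def)
  have c0: "c \<noteq> 0" using x(2) c by auto
  have "\<not> (\<exists>y\<in>anderson_ring. frac_const c * y = 1)"
  proof
    assume "\<exists>y\<in>anderson_ring. frac_const c * y = 1"
    then obtain y where "y \<in> anderson_ring" "frac_const c * y = 1" by blast
    moreover from this(2) have "y = frac_const 1 / frac_const c"
      using c0 by (simp add: field_simps flip: one_pCons)
    ultimately have "to_fract 1 / to_fract c \<in> base_ring"
      using const_mem_anderson_ring_iff[OF c0, of 1] by simp
    moreover have "x * (to_fract 1 / to_fract c) = 1" using c x(2) by simp
    ultimately show False using nonunit by blast
  qed
  moreover have "frac_const c \<noteq> 0" using c0 by simp
  ultimately have "finite {Q. maximal_w_ideal anderson_ring Q \<and> frac_const c \<in> Q}"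
    using R poly_mem_anderson_ring unfolding finite_w_character_def by blast
  moreover have "frac_const c \<in> extension M" if "maximal_w_ideal base_ring M" "x \<in> M" for M
  proof -
    have "submodule base_ring M"
      using that(1) by (auto simp: base.maximal_w_ideal_iff dest: proper_wD(1))
    then show ?thesis using that(2) c const_mem_extension_iff by blast
  qed
  then have "extension ` {M. maximal_w_ideal base_ring M \<and> x \<in> M}
      \<subseteq> {Q. maximal_w_ideal anderson_ring Q \<and> frac_const c \<in> Q}"
    using maximal_w_ideal_extension by blast
  ultimately have "finite (extension ` {M. maximal_w_ideal base_ring M \<and> x \<in> M})"
    by (rule finite_subset[rotated])
  moreover have "inj_on extension {M. maximal_w_ideal base_ring M \<and> x \<in> M}"
    by (rule inj_on_subset[OF inj_on_extension]) blast
  ultimately show "finite {M. maximal_w_ideal base_ring M \<and> x \<in> M}"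
    by (rule finite_imageD)
qed

theorem proposition4p10:
  "finite_w_character (base_ring :: 'a::idom fract set) \<longleftrightarrow>
   finite_w_character (anderson_ring :: 'a poly fract set)"
  using finite_w_character_anderson_ring finite_w_character_base_ring by blast

end
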